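(* Let $\mu\ge 1$, $0\le\gamma<1$, $-1\le B<A\le 1$, $-1\le B<0$, and let $k\ge m$ be non-negative integers. Let $\Phi_\mu(z)=z+\sum_{n=2}^\infty\vartheta_n z^{\mu n}$ and $\Psi_\mu(z)=z+\sum_{n=2}^\infty\lambda_n z^{\mu n}$ be convergent in $\mathbb U$ with $\vartheta_n\ge 0$, $\lambda_n\ge 0$, $\vartheta_n\ge\lambda_n$ for all $n\ge 2$. If $F_\mu(z)=z+\sum_{n=2}^\infty a_nz^{\mu n}\in\mathcal A_\mu$ satisfies $$\sum_{n=2}^{\infty}\Big[(1-B)\big((\mu n)^k\vartheta_n-(\mu n)^m\lambda_n\big)+(A-B)(1-\gamma)(\mu n)^m\lambda_n\Big]|a_n|\le (A-B)(1-\gamma),$$ then $F_\mu\in\mathcal E_{k,m}(\Phi_\mu,\Psi_\mu,A,B,\mu,\gamma)$.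
   Context: $\mathbb U=\{z\in\mathbb C:|z|<1\}$. For real $\mu\ge1$, powers $z^{s}$ with $s>0$ are taken with the principal branch for $z\ne0$, and equal $0$ at $z=0$. $\mathcal A_\mu$ is the class of functions $F_\mu(z)=z+\sum_{n=2}^\infty a_nz^{\mu n}$ ($a_n\in\mathbb C$) whose series converges in $\mathbb U$. For $F_\mu(z)=z+\sum_{n\ge2}a_nz^{\mu n}$ and $G_\mu(z)=z+\sum_{n\ge2}b_nz^{\mu n}$ the convolution is $(F_\mu*G_\mu)(z)=z+\sum_{n\ge2}a_nb_nz^{\mu n}$. For a non-negative integer $\beta$ the operator $D_\mu^\beta$ is $D_\mu^\beta F_\mu(z)=z+\sum_{n=2}^\infty(\mu n)^\beta a_nz^{\mu n}$. A function $F_\mu\in\mathcal A_\mu$ belongs to $\mathcal E_{k,m}(\Phi_\mu,\Psi_\mu,A,B,\mu,\gamma)$ if, for all $z$ with $0<|z|<1$, $(F_\mu*\Psi_\mu)(z)\neq0$, $D_\mu^m(F_\mu*\Psi_\mu)(z)\ne0$, and the quotient $q(z)=\dfrac{D_\mu^k(F_\mu*\Phi_\mu)(z)}{D_\mu^m(F_\mu*\Psi_\mu)(z)}$ satisfies $$\left|\frac{q(z)-1}{(A-B)(1-\gamma)-B\,(q(z)-1)}\right|<1,$$ with the denominator non-zero. (This is the inequality form of the subordination $q(z)\prec(1-\gamma)\frac{1+Az}{1+Bz}+\gamma$.) *)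

theory Defs
  imports "HOL-Complex_Analysis.Complex_Analysis"
begin

text \<open>
  Series \<open>z + (\<Sum>n\<ge>2. a n * z powr (\<mu> * n))\<close>, for real \<open>\<mu> \<ge> 1\<close>.  The complex \<^const>\<open>powr\<close> is the
  principal branch, and \<open>0 powr s = 0\<close>.  The summation index is shifted by 2, so the values
  \<open>a 0\<close> and \<open>a 1\<close> of a coefficient sequence are never used.
\<close>

definition mu_term :: "real \<Rightarrow> (nat \<Rightarrow> complex) \<Rightarrow> complex \<Rightarrow> nat \<Rightarrow> complex" where
  "mu_term \<mu> a z n = a n * z powr complex_of_real (\<mu> * real n)"

definition mu_series :: "real \<Rightarrow> (nat \<Rightarrow> complex) \<Rightarrow> complex \<Rightarrow> complex" where
  "mu_series \<mu> a z = z + (\<Sum>n. mu_term \<mu> a z (n + 2))"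

definition has_mu_expansion :: "real \<Rightarrow> (complex \<Rightarrow> complex) \<Rightarrow> (nat \<Rightarrow> complex) \<Rightarrow> bool" where
  "has_mu_expansion \<mu> F a \<longleftrightarrow>
     (\<forall>z\<in>ball 0 1. summable (\<lambda>n. mu_term \<mu> a z (n + 2)) \<and> F z = mu_series \<mu> a z)"

text \<open>Membership restricts a function only on the open unit disc; its values elsewhere are irrelevant.\<close>

definition class_A :: "real \<Rightarrow> (complex \<Rightarrow> complex) set" where
  "class_A \<mu> = {F. \<exists>a. has_mu_expansion \<mu> F a}"

text \<open>
  For \<open>\<mu> \<ge> 1\<close> the coefficients with index at least 2 are uniquely determined by the function, see
  \<open>has_mu_expansion_unique\<close> below; hence the choice made here does not matter for members
  of \<^const>\<open>class_A\<close>.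
\<close>

definition mu_coeff :: "real \<Rightarrow> (complex \<Rightarrow> complex) \<Rightarrow> nat \<Rightarrow> complex" where
  "mu_coeff \<mu> F = (SOME a. has_mu_expansion \<mu> F a)"

definition mu_conv :: "real \<Rightarrow> (complex \<Rightarrow> complex) \<Rightarrow> (complex \<Rightarrow> complex) \<Rightarrow> complex \<Rightarrow> complex" where
  "mu_conv \<mu> F G = mu_series \<mu> (\<lambda>n. mu_coeff \<mu> F n * mu_coeff \<mu> G n)"

definition mu_D :: "real \<Rightarrow> nat \<Rightarrow> (complex \<Rightarrow> complex) \<Rightarrow> complex \<Rightarrow> complex" where
  "mu_D \<mu> \<beta> F = mu_series \<mu> (\<lambda>n. complex_of_real ((\<mu> * real n) ^ \<beta>) * mu_coeff \<mu> F n)"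

definition class_E ::
  "nat \<Rightarrow> nat \<Rightarrow> (complex \<Rightarrow> complex) \<Rightarrow> (complex \<Rightarrow> complex) \<Rightarrow> real \<Rightarrow> real \<Rightarrow> real \<Rightarrow> real
     \<Rightarrow> (complex \<Rightarrow> complex) set" where
  "class_E k m \<Phi> \<Psi> A B \<mu> \<gamma> =
    {F \<in> class_A \<mu>. \<forall>z. 0 < norm z \<and> norm z < 1 \<longrightarrow>
       mu_conv \<mu> F \<Psi> z \<noteq> 0 \<and>
       mu_D \<mu> m (mu_conv \<mu> F \<Psi>) z \<noteq> 0 \<and>
       (let q = mu_D \<mu> k (mu_conv \<mu> F \<Phi>) z / mu_D \<mu> m (mu_conv \<mu> F \<Psi>) z;
            d = complex_of_real ((A - B) * (1 - \<gamma>)) - complex_of_real B * (q - 1)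
        in d \<noteq> 0 \<and> norm ((q - 1) / d) < 1)}"

lemma has_mu_expansion_unique:
  assumes mu: "1 \<le> \<mu>" and a: "has_mu_expansion \<mu> F a" and b: "has_mu_expansion \<mu> F b"
    and n: "2 \<le> n"
  shows "a n = b n"
proof (rule ccontr)
  assume ne: "a n \<noteq> b n"
  define c where "c j = (if j < 2 then 0 else a j - b j)" for j
  have pos: "(\<lambda>j. c j * complex_of_real t ^ j) sums 0" if t: "0 < t" "t < 1" for t :: real
  proof -
    define x where "x = t powr (1 / \<mu>)"
    have x: "0 < x" "x < 1"
      using t mu powr_less_mono2[of "1 / \<mu>" t 1] by (auto simp: x_def)
    have pw: "complex_of_real x powr complex_of_real (\<mu> * real j) = complex_of_real t ^ j" for j
    proof -
      have "x powr (\<mu> * real j) = t powr (real j)"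
        using mu by (simp add: x_def powr_powr)
      also have "\<dots> = t ^ j" using t by (simp add: powr_realpow)
      finally show ?thesis using x by (metis less_eq_real_def of_real_power powr_of_real)
    qed
    have xb: "complex_of_real x \<in> ball 0 1" using x by simp
    have sm: "summable (\<lambda>j. mu_term \<mu> a x (j + 2))" "summable (\<lambda>j. mu_term \<mu> b x (j + 2))"
      and "mu_series \<mu> a x = mu_series \<mu> b x"
      using a b xb unfolding has_mu_expansion_def by metis+
    then have "(\<lambda>j. mu_term \<mu> a x (j + 2) - mu_term \<mu> b x (j + 2)) sums 0"
      using sums_diff[OF sm[THEN summable_sums]] by (simp add: mu_series_def)
    then have "(\<lambda>j. c (j + 2) * complex_of_real t ^ (j + 2)) sums 0"
      unfolding mu_term_def pw by (simp add: c_def algebra_simps)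
    then show ?thesis
      by (subst (asm) sums_iff_shift) (simp add: c_def numeral_2_eq_2)
  qed
  define f where "f w = (\<Sum>j. c j * w ^ j)" for w
  have sums: "(\<lambda>j. c j * (w - 0) ^ j) sums f w" if "norm (w - 0) < 1 / 2" for w
  proof -
    have "summable (\<lambda>j. c j * complex_of_real (1 / 2) ^ j)"
      using pos[of "1 / 2"] by (simp add: sums_iff)
    then have "summable (\<lambda>j. c j * w ^ j)"
      by (rule powser_inside) (use that in \<open>simp add: norm_divide\<close>)
    then show ?thesis by (simp add: f_def summable_sums)
  qed
  have f0: "f 0 = 0" unfolding f_def by (subst powser_zero) (simp add: c_def)
  have cn: "c n \<noteq> 0" and n0: "n > 0" using n ne by (auto simp: c_def)
  obtain s where s: "0 < s" "\<And>z. z \<in> cball 0 s - {0} \<Longrightarrow> f z \<noteq> 0"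
    using powser_0_nonzero[OF _ sums f0 cn n0, of "1 / 2"] by auto
  define t where "t = min s (1 / 2)"
  have t: "0 < t" "t < 1" "t \<le> s" using s(1) by (auto simp: t_def)
  have "f (complex_of_real t) = 0" using pos[OF t(1,2)] by (simp add: f_def sums_iff)
  moreover have "f (complex_of_real t) \<noteq> 0" using s(2)[of "complex_of_real t"] t by auto
  ultimately show False by blast
qed

end

theory Submission
  imports Defs
begin

text \<open>
  Write \<open>P n = (\<mu> n)^k \<theta> n\<close>, \<open>Q n = (\<mu> n)^m l n\<close> and \<open>C = (A - B) (1 - \<gamma>)\<close>, so that
  \<open>0 \<le> Q n \<le> P n\<close>.  The quotient in the definition of the class is \<open>q = N / M\<close> with
  \<open>N = z + (\<Sum>n\<ge>2. P n a n z^(\<mu> n))\<close> and \<open>M = z + (\<Sum>n\<ge>2. Q n a n z^(\<mu> n))\<close>.  Multiplying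
  through by \<open>M\<close>, the claim becomes \<open>norm (N - M) < norm (C M - B (N - M))\<close>.  The linear term
  \<open>z\<close> cancels in \<open>N - M\<close> but survives as \<open>C z\<close> on the right, and every other power of \<open>z\<close> is at
  most \<open>norm z powr (2 \<mu>) < norm z\<close> in modulus.  By the triangle inequality the claim therefore
  follows from
  \<open>(\<Sum>n\<ge>2. (P n - Q n) norm (a n)) + (\<Sum>n\<ge>2. (C Q n - B (P n - Q n)) norm (a n)) \<le> C\<close>,
  and this is the coefficient hypothesis.  Strictness comes from \<open>norm z powr (2 \<mu>) < norm z\<close>.

  The same principle, in \<open>mu_series_nonzero\<close>, shows that the two denominators do not vanish:
  the hypothesis dominates \<open>C (\<Sum>n\<ge>2. Q n norm (a n))\<close>, and \<open>l n \<le> Q n\<close>.  It also makes all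
  the series involved absolutely convergent in the disc, so that the convolutions have expansions;
  uniqueness of coefficients then identifies the operators applied to them with the series
  \<open>N\<close> and \<open>M\<close>.
\<close>

section \<open>Estimates for the tail of a series\<close>

lemma norm_mu_term_le:
  assumes "1 \<le> \<mu>" "norm z < 1" "2 \<le> n"
  shows "norm (mu_term \<mu> c z n) \<le> norm (c n) * norm z powr (2 * \<mu>)"
proof -
  have "norm (z powr complex_of_real (\<mu> * real n)) = norm z powr (\<mu> * real n)"
    by (subst norm_powr_real_powr') auto
  also have "\<dots> \<le> norm z powr (2 * \<mu>)"
    using assms by (intro powr_mono') auto
  finally show ?thesis
    by (simp add: mu_term_def norm_mult mult_left_mono)
qed

lemma summable_mu_term:
  assumes "1 \<le> \<mu>" "norm z < 1" "summable (\<lambda>n. norm (c (n + 2)))"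
  shows "summable (\<lambda>n. norm (mu_term \<mu> c z (n + 2)))"
  by (rule summable_comparison_test'[OF summable_mult2[OF assms(3), of "norm z powr (2 * \<mu>)"]])
     (use norm_mu_term_le[OF assms(1,2)] in auto)

lemma norm_suminf_mu_term_le:
  assumes "1 \<le> \<mu>" "norm z < 1" "summable (\<lambda>n. norm (c (n + 2)))"
  shows "norm (\<Sum>n. mu_term \<mu> c z (n + 2)) \<le> (\<Sum>n. norm (c (n + 2))) * norm z powr (2 * \<mu>)"
proof -
  have "norm (\<Sum>n. mu_term \<mu> c z (n + 2)) \<le> (\<Sum>n. norm (mu_term \<mu> c z (n + 2)))"
    by (rule summable_norm[OF summable_mu_term[OF assms]])
  also have "\<dots> \<le> (\<Sum>n. norm (c (n + 2)) * norm z powr (2 * \<mu>))"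
    by (intro suminf_le summable_mu_term summable_mult2 norm_mu_term_le assms) auto
  finally show ?thesis
    using suminf_mult2[OF assms(3)] by simp
qed

lemma powr_double_less_self:
  fixes r :: real
  assumes "1 \<le> \<mu>" "0 < r" "r < 1"
  shows "r powr (2 * \<mu>) < r"
  using powr_less_mono'[of r 1 "2 * \<mu>"] assms by simp

text \<open>The linear term dominates the tail, because the tail is bounded by \<open>norm z powr (2 * \<mu>)\<close>.\<close>

lemma mu_series_nonzero:
  assumes "1 \<le> \<mu>" "0 < norm z" "norm z < 1"
    and "summable (\<lambda>n. norm (c (n + 2)))" "(\<Sum>n. norm (c (n + 2))) \<le> 1"
  shows "mu_series \<mu> c z \<noteq> 0"
proof
  assume "mu_series \<mu> c z = 0"
  then have "norm z = norm (\<Sum>n. mu_term \<mu> c z (n + 2))"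
    by (metis add_eq_0_iff2 mu_series_def norm_minus_cancel)
  also have "\<dots> \<le> (\<Sum>n. norm (c (n + 2))) * norm z powr (2 * \<mu>)"
    by (rule norm_suminf_mu_term_le) (use assms in auto)
  also have "\<dots> \<le> 1 * norm z powr (2 * \<mu>)"
    by (rule mult_right_mono) (use assms in auto)
  finally show False
    using powr_double_less_self[of \<mu> "norm z"] assms by simp
qed

section \<open>Expansions and coefficients\<close>

lemma mu_series_cong:
  assumes "\<And>n. 2 \<le> n \<Longrightarrow> c n = d n"
  shows "mu_series \<mu> c = mu_series \<mu> d"
  using assms by (simp add: mu_series_def mu_term_def fun_eq_iff)

lemma mu_coeff_eq:
  assumes "1 \<le> \<mu>" "has_mu_expansion \<mu> F a" "2 \<le> n"
  shows "mu_coeff \<mu> F n = a n"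
  using has_mu_expansion_unique[OF assms(1) _ assms(2,3)] someI[of "has_mu_expansion \<mu> F", OF assms(2)]
  by (simp add: mu_coeff_def)

lemma has_mu_expansion_mu_series:
  assumes "1 \<le> \<mu>" "summable (\<lambda>n. norm (c (n + 2)))"
  shows "has_mu_expansion \<mu> (mu_series \<mu> c) c"
  using summable_mu_term[OF assms(1) _ assms(2)]
  by (auto simp: has_mu_expansion_def intro: summable_norm_cancel)

lemma mu_conv_eq:
  assumes "1 \<le> \<mu>" "has_mu_expansion \<mu> F a" "has_mu_expansion \<mu> G b"
  shows "mu_conv \<mu> F G = mu_series \<mu> (\<lambda>n. a n * b n)"
  unfolding mu_conv_def by (rule mu_series_cong) (simp add: mu_coeff_eq[OF assms(1,2)] mu_coeff_eq[OF assms(1,3)])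

text \<open>
  Absolute summability of the coefficients gives the convolution an expansion in the disc; without
  one, \<^const>\<open>mu_coeff\<close> need not return the products \<open>a n * b n\<close>.
\<close>

lemma mu_D_mu_conv_eq:
  assumes "1 \<le> \<mu>" "has_mu_expansion \<mu> F a" "has_mu_expansion \<mu> G b"
    and "summable (\<lambda>n. norm (a (n + 2) * b (n + 2)))"
  shows "mu_D \<mu> \<beta> (mu_conv \<mu> F G)
       = mu_series \<mu> (\<lambda>n. complex_of_real ((\<mu> * real n) ^ \<beta>) * (a n * b n))"
proof -
  have "has_mu_expansion \<mu> (mu_conv \<mu> F G) (\<lambda>n. a n * b n)"
    unfolding mu_conv_eq[OF assms(1-3)]
    by (rule has_mu_expansion_mu_series) (use assms in auto)
  from mu_coeff_eq[OF assms(1) this] show ?thesis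
    unfolding mu_D_def by (intro mu_series_cong) simp
qed

section \<open>The coefficient criterion\<close>

text \<open>
  The inequality is the one for \<open>q = N / M\<close> after multiplying numerator and denominator by \<open>M\<close>.
  Since \<open>B \<le> 0\<close> and \<open>q n \<le> p n\<close>, the coefficients \<open>p n - q n\<close> of \<open>N - M\<close> and
  \<open>C * q n - B * (p n - q n)\<close> of \<open>C * M - B * (N - M)\<close> are nonnegative, so their moduli add up to
  exactly the weights in the hypothesis.
\<close>

lemma mu_series_coefficient_criterion:
  fixes p q :: "nat \<Rightarrow> real" and a :: "nat \<Rightarrow> complex" and B C \<mu> :: real
  assumes mu: "1 \<le> \<mu>" and z: "0 < norm z" "norm z < 1" and C: "0 < C" and B: "B \<le> 0"
    and q: "\<And>n. 2 \<le> n \<Longrightarrow> 0 \<le> q n" and pq: "\<And>n. 2 \<le> n \<Longrightarrow> q n \<le> p n"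
    and sp: "summable (\<lambda>n. p (n + 2) * norm (a (n + 2)))"
    and sq: "summable (\<lambda>n. q (n + 2) * norm (a (n + 2)))"
    and le: "(\<Sum>n. ((1 - B) * (p (n + 2) - q (n + 2)) + C * q (n + 2)) * norm (a (n + 2))) \<le> C"
  defines "N \<equiv> mu_series \<mu> (\<lambda>n. complex_of_real (p n) * a n) z"
    and "M \<equiv> mu_series \<mu> (\<lambda>n. complex_of_real (q n) * a n) z"
  shows "norm (N - M) < norm (complex_of_real C * M - complex_of_real B * (N - M))"
proof -
  define u where "u n = complex_of_real (p n - q n) * a n" for n
  define v where "v n = complex_of_real (C * q n - B * (p n - q n)) * a n" for n
  have norm_u: "norm (u (n + 2)) = (p (n + 2) - q (n + 2)) * norm (a (n + 2))" for n
    unfolding u_def norm_mult norm_of_real using pq[of "n + 2"] by simp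
  have norm_v: "norm (v (n + 2)) = (C * q (n + 2) - B * (p (n + 2) - q (n + 2))) * norm (a (n + 2))"
    for n
  proof -
    have "0 \<le> C * q (n + 2)" "B * (p (n + 2) - q (n + 2)) \<le> 0"
      using pq[of "n + 2"] q[of "n + 2"] C B by (auto intro: mult_nonpos_nonneg)
    then show ?thesis
      unfolding v_def norm_mult norm_of_real by simp
  qed
  have su: "summable (\<lambda>n. norm (u (n + 2)))"
    unfolding norm_u using summable_diff[OF sp sq] by (simp add: algebra_simps)
  have sv: "summable (\<lambda>n. norm (v (n + 2)))"
    unfolding norm_v
    using summable_diff[OF summable_mult[OF sq, of C] summable_mult[OF summable_diff[OF sp sq], of B]]
    by (simp add: algebra_simps)
  have "(\<Sum>n. norm (u (n + 2))) + (\<Sum>n. norm (v (n + 2))) = (\<Sum>n. norm (u (n + 2)) + norm (v (n + 2)))"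
    by (rule suminf_add[OF su sv])
  also have "\<dots> \<le> C"
    using le unfolding norm_u norm_v by (simp add: algebra_simps)
  finally have uv: "(\<Sum>n. norm (u (n + 2))) + (\<Sum>n. norm (v (n + 2))) \<le> C" .

  have nonneg: "0 \<le> p (n + 2)" "0 \<le> q (n + 2)" for n
    using q[of "n + 2"] pq[of "n + 2"] by auto
  have P: "(\<lambda>n. mu_term \<mu> (\<lambda>n. complex_of_real (p n) * a n) z (n + 2)) sums (N - z)"
    using summable_mu_term[OF mu z(2), of "\<lambda>n. complex_of_real (p n) * a n"] sp nonneg
    by (simp add: N_def mu_series_def norm_mult summable_norm_cancel summable_sums)
  have Q: "(\<lambda>n. mu_term \<mu> (\<lambda>n. complex_of_real (q n) * a n) z (n + 2)) sums (M - z)"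
    using summable_mu_term[OF mu z(2), of "\<lambda>n. complex_of_real (q n) * a n"] sq nonneg
    by (simp add: M_def mu_series_def norm_mult summable_norm_cancel summable_sums)
  have U: "(\<lambda>n. mu_term \<mu> u z (n + 2)) sums (N - M)"
    using sums_diff[OF P Q] by (simp add: mu_term_def u_def algebra_simps)
  have V: "(\<lambda>n. mu_term \<mu> v z (n + 2)) sums
      (complex_of_real C * (M - z) - complex_of_real B * (N - M))"
    using sums_diff[OF sums_mult[OF Q, of "complex_of_real C"] sums_mult[OF U, of "complex_of_real B"]]
    by (simp add: mu_term_def u_def v_def algebra_simps)

  have "norm (N - M) + norm (complex_of_real C * (M - z) - complex_of_real B * (N - M))
      \<le> ((\<Sum>n. norm (u (n + 2))) + (\<Sum>n. norm (v (n + 2)))) * norm z powr (2 * \<mu>)"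
    using norm_suminf_mu_term_le[OF mu z(2) su] norm_suminf_mu_term_le[OF mu z(2) sv]
    unfolding sums_unique[OF U, symmetric] sums_unique[OF V, symmetric] by (simp add: distrib_right)
  also have "\<dots> \<le> C * norm z powr (2 * \<mu>)"
    using uv by (rule mult_right_mono) simp
  also have "\<dots> < C * norm z"
    using powr_double_less_self[OF mu z] C by simp
  also have "C * norm z = norm (complex_of_real C * z)"
    using C by (simp add: norm_mult)
  also have "complex_of_real C * z = (complex_of_real C * M - complex_of_real B * (N - M))
      - (complex_of_real C * (M - z) - complex_of_real B * (N - M))"
    by (simp add: algebra_simps)
  also have "norm \<dots> \<le> norm (complex_of_real C * M - complex_of_real B * (N - M))
      + norm (complex_of_real C * (M - z) - complex_of_real B * (N - M))"
    by (rule norm_triangle_ineq4)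
  finally show ?thesis by simp
qed

theorem theorem1:
  fixes \<mu> \<gamma> A B :: real and k m :: nat
    and F \<Phi> \<Psi> :: "complex \<Rightarrow> complex"
    and a :: "nat \<Rightarrow> complex" and \<theta> l :: "nat \<Rightarrow> real"
  assumes "1 \<le> \<mu>" and "0 \<le> \<gamma>" and "\<gamma> < 1"
    and "-1 \<le> B" and "B < A" and "A \<le> 1" and "B < 0"
    and "m \<le> k"
    and "has_mu_expansion \<mu> \<Phi> (\<lambda>n. complex_of_real (\<theta> n))"
    and "has_mu_expansion \<mu> \<Psi> (\<lambda>n. complex_of_real (l n))"
    and "\<And>n. 2 \<le> n \<Longrightarrow> 0 \<le> \<theta> n"
    and "\<And>n. 2 \<le> n \<Longrightarrow> 0 \<le> l n"
    and "\<And>n. 2 \<le> n \<Longrightarrow> l n \<le> \<theta> n"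
    and "has_mu_expansion \<mu> F a"
    and "summable (\<lambda>j. let n = j + 2 in
           ((1 - B) * ((\<mu> * real n) ^ k * \<theta> n - (\<mu> * real n) ^ m * l n)
             + (A - B) * (1 - \<gamma>) * (\<mu> * real n) ^ m * l n) * norm (a n))"
    and "(\<Sum>j. let n = j + 2 in
           ((1 - B) * ((\<mu> * real n) ^ k * \<theta> n - (\<mu> * real n) ^ m * l n)
             + (A - B) * (1 - \<gamma>) * (\<mu> * real n) ^ m * l n) * norm (a n))
         \<le> (A - B) * (1 - \<gamma>)"
  shows "F \<in> class_E k m \<Phi> \<Psi> A B \<mu> \<gamma>"
proof -
  note mu = assms(1) and F = assms(14) and Phi = assms(9) and Psi = assms(10)
  define C where "C = (A - B) * (1 - \<gamma>)"
  define P where "P n = (\<mu> * real n) ^ k * \<theta> n" for n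
  define Q where "Q n = (\<mu> * real n) ^ m * l n" for n
  define W where "W n = ((1 - B) * (P n - Q n) + C * Q n) * norm (a n)" for n
  have C: "0 < C" using assms by (simp add: C_def)
  have sW: "summable (\<lambda>n. W (n + 2))" and W_le: "(\<Sum>n. W (n + 2)) \<le> C"
    using assms(15,16) by (simp_all add: W_def P_def Q_def C_def Let_def mult.assoc)

  have ge1: "1 \<le> \<mu> * real n" if "2 \<le> n" for n
    using mult_mono[of 1 \<mu> 1 "real n"] mu that by simp
  have l_le: "l n \<le> Q n" and th_le: "\<theta> n \<le> P n" and Q_le: "Q n \<le> P n" and Q0: "0 \<le> Q n"
    if n: "2 \<le> n" for n
  proof -
    note pw = one_le_power[OF ge1[OF n]]
    show "l n \<le> Q n" "\<theta> n \<le> P n" "0 \<le> Q n"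
      using mult_right_mono[OF pw assms(12)[OF n], of m]
        mult_right_mono[OF pw assms(11)[OF n], of k] assms(12)[OF n] pw[of m]
      by (auto simp: P_def Q_def)
    show "Q n \<le> P n"
      unfolding P_def Q_def using assms(8,11-13) n ge1[OF n]
      by (intro mult_mono power_increasing) auto
  qed

  have CQ_le: "C * (Q n * norm (a n)) \<le> W n"
    and PQ_le: "(P n - Q n) * norm (a n) \<le> W n" if n: "2 \<le> n" for n
  proof -
    have b: "P n - Q n \<le> (1 - B) * (P n - Q n)" "0 \<le> C * Q n"
      using Q_le[OF n] Q0[OF n] C assms(7) mult_right_mono[of 1 "1 - B" "P n - Q n"] by auto
    then have "C * Q n * norm (a n) \<le> W n" "(P n - Q n) * norm (a n) \<le> W n"
      unfolding W_def using Q_le[OF n] by (auto intro!: mult_right_mono)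
    then show "C * (Q n * norm (a n)) \<le> W n" "(P n - Q n) * norm (a n) \<le> W n"
      by (simp_all add: mult.assoc)
  qed
  have sCQ: "summable (\<lambda>n. C * (Q (n + 2) * norm (a (n + 2))))"
    by (rule summable_comparison_test'[OF sW]) (use CQ_le Q0 C in \<open>auto simp: abs_mult\<close>)
  then have sQ: "summable (\<lambda>n. Q (n + 2) * norm (a (n + 2)))"
    using C by (simp add: summable_cmult_iff)
  have "summable (\<lambda>n. (P (n + 2) - Q (n + 2)) * norm (a (n + 2)))"
    by (rule summable_comparison_test'[OF sW]) (use PQ_le Q_le in \<open>auto simp: abs_mult\<close>)
  from summable_add[OF this sQ] have sP: "summable (\<lambda>n. P (n + 2) * norm (a (n + 2)))"
    by (simp add: algebra_simps)
  have "C * (\<Sum>n. Q (n + 2) * norm (a (n + 2))) \<le> (\<Sum>n. W (n + 2))"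
    unfolding suminf_mult[OF sQ, symmetric] by (intro suminf_le sCQ sW CQ_le) simp
  also have "\<dots> \<le> C * 1" using W_le by simp
  finally have Q_sum: "(\<Sum>n. Q (n + 2) * norm (a (n + 2))) \<le> 1"
    using C by simp

  have l_bound: "norm (a (n + 2) * complex_of_real (l (n + 2))) \<le> Q (n + 2) * norm (a (n + 2))"
    and th_bound: "norm (a (n + 2) * complex_of_real (\<theta> (n + 2))) \<le> P (n + 2) * norm (a (n + 2))" for n
    using l_le[of "n + 2"] th_le[of "n + 2"] assms(11,12)[of "n + 2"]
    by (auto simp: norm_mult mult.commute[of "norm (a _)"] intro!: mult_right_mono)
  have sl: "summable (\<lambda>n. norm (a (n + 2) * complex_of_real (l (n + 2))))"
    by (rule summable_comparison_test'[OF sQ]) (use l_bound in auto)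
  have sth: "summable (\<lambda>n. norm (a (n + 2) * complex_of_real (\<theta> (n + 2))))"
    by (rule summable_comparison_test'[OF sP]) (use th_bound in auto)
  have l_sum: "(\<Sum>n. norm (a (n + 2) * complex_of_real (l (n + 2)))) \<le> 1"
    using suminf_le[OF l_bound sl sQ] Q_sum by simp

  have conv: "mu_conv \<mu> F \<Psi> = mu_series \<mu> (\<lambda>n. a n * complex_of_real (l n))"
    by (rule mu_conv_eq[OF mu F Psi])
  have DM: "mu_D \<mu> m (mu_conv \<mu> F \<Psi>) = mu_series \<mu> (\<lambda>n. complex_of_real (Q n) * a n)"
    unfolding mu_D_mu_conv_eq[OF mu F Psi sl] by (simp add: Q_def mult_ac)
  have DN: "mu_D \<mu> k (mu_conv \<mu> F \<Phi>) = mu_series \<mu> (\<lambda>n. complex_of_real (P n) * a n)"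
    unfolding mu_D_mu_conv_eq[OF mu F Phi sth] by (simp add: P_def mult_ac)

  have normQ: "norm (complex_of_real (Q (n + 2)) * a (n + 2)) = Q (n + 2) * norm (a (n + 2))" for n
    using Q0[of "n + 2"] by (simp add: norm_mult)

  show ?thesis
    unfolding class_E_def
  proof (intro CollectI conjI allI impI)
    show "F \<in> class_A \<mu>" using F by (auto simp: class_A_def)
  next
    fix z :: complex assume z: "0 < norm z \<and> norm z < 1"
    show "mu_conv \<mu> F \<Psi> z \<noteq> 0"
      unfolding conv by (rule mu_series_nonzero) (use mu z sl l_sum in auto)
    define M where "M = mu_series \<mu> (\<lambda>n. complex_of_real (Q n) * a n) z"
    define N where "N = mu_series \<mu> (\<lambda>n. complex_of_real (P n) * a n) z"
    have M0: "M \<noteq> 0"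
      unfolding M_def
      by (rule mu_series_nonzero) (use mu z sQ Q_sum in \<open>simp_all only: normQ\<close>)
    then show "mu_D \<mu> m (mu_conv \<mu> F \<Psi>) z \<noteq> 0"
      by (simp add: DM M_def)
    have less: "norm (N - M) < norm (complex_of_real C * M - complex_of_real B * (N - M))"
      unfolding N_def M_def
      by (rule mu_series_coefficient_criterion)
         (use mu z C assms(7) Q0 Q_le sP sQ W_le in \<open>auto simp: W_def\<close>)
    define d where "d = complex_of_real C - complex_of_real B * (N / M - 1)"
    have qM: "N / M - 1 = (N - M) / M" using M0 by (simp add: field_simps)
    have dM: "d = (complex_of_real C * M - complex_of_real B * (N - M)) / M"
      using M0 by (simp add: d_def field_simps)
    have "d \<noteq> 0" using less M0 unfolding dM by auto
    moreover have "norm ((N / M - 1) / d) < 1"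
      unfolding qM dM using less le_less_trans[OF norm_ge_zero less] M0
      by (simp add: norm_divide)
    ultimately show "let q = mu_D \<mu> k (mu_conv \<mu> F \<Phi>) z / mu_D \<mu> m (mu_conv \<mu> F \<Psi>) z;
            d = complex_of_real ((A - B) * (1 - \<gamma>)) - complex_of_real B * (q - 1)
        in d \<noteq> 0 \<and> norm ((q - 1) / d) < 1"
      unfolding Let_def DM DN M_def N_def d_def C_def by blast
  qed
qed

end
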